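(* Let $A$ and $B$ be any two positive semidefinite complex $n\times n$ matrices, let $r\ge 0$ be any real number, and let $s\ge 1$ be any integer. Then $$\mathrm{Tr}\left((\Sigma_\uparrow(A))^s\,(\Sigma_\uparrow(B))^{s+r}\right)\ \ge\ \mathrm{Tr}\left(B^r\,(B^{1/2}AB^{1/2})^s\right).$$
   Context: Powers of positive semidefinite matrices are defined by the spectral calculus, with $B^0=I$. If $\sigma_1\ge\sigma_2\ge\dots\ge\sigma_n\ge 0$ are the singular values of an $n\times n$ matrix $X$ (the eigenvalues of $|X|=\sqrt{X^*X}$, counted with multiplicity), then $\Sigma_\uparrow(X)=\mathrm{diag}(\sigma_1,\sigma_2,\dots,\sigma_n)$ is the diagonal matrix with the singular values listed in this order down the diagonal. *)

theory Defs
  imports Jordan_Normal_Form.Schur_Decomposition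
begin

definition hermitian_mat :: "complex mat \<Rightarrow> bool" where
  "hermitian_mat A \<longleftrightarrow> square_mat A \<and> mat_adjoint A = A"

definition unitary_mat :: "complex mat \<Rightarrow> bool" where
  "unitary_mat U \<longleftrightarrow> square_mat U \<and> mat_adjoint U * U = 1\<^sub>m (dim_row U)"

text \<open>The order on the complex numbers is the one of \<^theory>\<open>HOL-Library.Complex_Order\<close>:
  \<open>z \<le> w\<close> means \<open>Re z \<le> Re w\<close> and \<open>Im z = Im w\<close>, so \<open>0 \<le> z\<close> says that \<open>z\<close> is real and nonnegative.\<close>

definition psd_mat :: "complex mat \<Rightarrow> bool" where
  "psd_mat A \<longleftrightarrow> hermitian_mat A \<and> (\<forall>v \<in> carrier_vec (dim_row A). 0 \<le> (A *\<^sub>v v) \<bullet>c v)"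

definition mat_trace :: "complex mat \<Rightarrow> complex" where
  "mat_trace A = (\<Sum>i<dim_row A. A $$ (i, i))"

text \<open>For Hermitian \<open>A\<close> a unitary diagonalization \<open>A = U diag(d) U*\<close> exists and
  \<open>U diag(f(d)) U*\<close> does not depend on its choice, so the description below is proper.
  For other matrices the value is unspecified.\<close>

definition spectral_calculus :: "(real \<Rightarrow> real) \<Rightarrow> complex mat \<Rightarrow> complex mat" where
  "spectral_calculus f A = (THE C. \<exists>U d.
     U \<in> carrier_mat (dim_row A) (dim_row A) \<and> unitary_mat U \<and>
     A = U * mat_diag (dim_row A) (\<lambda>i. complex_of_real (d i)) * mat_adjoint U \<and>
     C = U * mat_diag (dim_row A) (\<lambda>i. complex_of_real (f (d i))) * mat_adjoint U)"

text \<open>The exponent \<open>0\<close> is separated because \<^term>\<open>(0::real) powr 0 = 0\<close>, whereas \<open>B\<^sup>0 = I\<close>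
  is wanted also for singular \<open>B\<close>.\<close>

definition psd_powr :: "complex mat \<Rightarrow> real \<Rightarrow> complex mat" where
  "psd_powr B p = spectral_calculus (\<lambda>x. if p = 0 then 1 else x powr p) B"

definition mat_abs :: "complex mat \<Rightarrow> complex mat" where
  "mat_abs X = psd_powr (mat_adjoint X * X) (1/2)"

text \<open>The eigenvalues of \<open>|X|\<close> are real, so taking real parts only changes the type.
  The list is in decreasing order.\<close>

definition singular_values :: "complex mat \<Rightarrow> real list" where
  "singular_values X =
     rev (sorted_list_of_multiset (image_mset Re (proots (char_poly (mat_abs X)))))"

definition Sigma_up :: "complex mat \<Rightarrow> complex mat" where
  "Sigma_up X = mat_diag (dim_row X) (\<lambda>i. complex_of_real (singular_values X ! i))"

end

theory Submission
  imports Defs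
begin

text \<open>
  Write \<open>S = B\<^sup>1\<^sup>/\<^sup>2\<close>, \<open>R = B\<^sup>r\<close>, and let \<open>a\<close>, \<open>b\<close> be the decreasing eigenvalue sequences of
  \<open>A\<close> and \<open>B\<close>. Since \<open>s\<close> is an integer and \<open>S S = B\<close>, the power \<open>(S A S)\<^sup>s\<close> is the word
  \<open>S (A B)\<^sup>s\<^sup>-\<^sup>1 A S\<close>, so by cyclicity the trace on the right is that of the word
  \<open>(S R S) (A B)\<^sup>s\<^sup>-\<^sup>1 A\<close>, in which every factor is positive semidefinite. The claim is therefore a case of
  von Neumann's trace inequality for several factors:
  \<open>\<bar>Tr (X\<^sub>1 \<dots> X\<^sub>m)\<bar> \<le> (\<Sum>i. x\<^sub>1 i * \<dots> * x\<^sub>m i)\<close>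
  for positive semidefinite \<open>X\<^sub>j\<close> with decreasing eigenvalue sequences \<open>x\<^sub>j\<close>.

  That inequality is linear in each \<open>x\<^sub>j\<close>, and a decreasing nonnegative sequence is a nonnegative
  combination of indicators of initial segments \<open>{..<k}\<close> (summation by parts). For indicators every
  \<open>X\<^sub>j\<close> is an orthogonal projection, the right-hand side is the least of the ranks, and the
  left-hand side is the trace of a contraction through a space of that dimension.
  To treat one factor at a time, the predicate \<open>trace_dominated n M w\<close> bounds
  \<open>\<bar>Tr (K E\<^sub>k L M)\<bar>\<close> by \<open>\<Sum>i<k. w i\<close> for all contractions \<open>K\<close>, \<open>L\<close> and all \<open>k\<close>, where \<open>E\<^sub>k\<close> is the
  coordinate projection of rank \<open>k\<close>: the product \<open>K E\<^sub>k L\<close> records the projections already collected.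
  The lemma \<open>trace_dominated_spectral_mult\<close> multiplies \<open>M\<close> by one more positive
  semidefinite factor.

  The singular values of \<open>A\<close> enter through \<open>psd_sorted_diagonalization\<close>: a positive semidefinite
  matrix is its own absolute value, and it has a unitary diagonalization whose diagonal lists the
  eigenvalues in any prescribed order, in particular in decreasing order.
\<close>

section \<open>Adjoints and unitary matrices\<close>

lemma mat_adjoint_carrier [simp]:
  "A \<in> carrier_mat n m \<Longrightarrow> mat_adjoint A \<in> carrier_mat m n"
  unfolding mat_adjoint_def by (auto simp: mat_of_rows_def)

lemma mat_adjoint_dim [simp]:
  "dim_row (mat_adjoint A) = dim_col A" "dim_col (mat_adjoint A) = dim_row A"
  unfolding mat_adjoint_def by auto

lemma mat_adjoint_index [simp]:
  "i < dim_col A \<Longrightarrow> j < dim_row A \<Longrightarrow> mat_adjoint A $$ (i, j) = conjugate (A $$ (j, i))"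
  unfolding mat_adjoint_def by (auto simp: mat_of_rows_index)

lemma mat_adjoint_mult:
  fixes A B :: "complex mat"
  assumes "A \<in> carrier_mat n m" "B \<in> carrier_mat m k"
  shows "mat_adjoint (A * B) = mat_adjoint B * mat_adjoint A"
  using assms
  by (intro eq_matI) (auto simp: scalar_prod_def mult.commute)

lemma mat_adjoint_adjoint [simp]: "mat_adjoint (mat_adjoint (A :: complex mat)) = A"
  by (intro eq_matI) auto

lemma mat_adjoint_one [simp]: "mat_adjoint (1\<^sub>m n :: complex mat) = 1\<^sub>m n"
  by (intro eq_matI) auto

lemma mat_adjoint_mat_diag_real [simp]:
  "mat_adjoint (mat_diag n (\<lambda>i. complex_of_real (d i))) = mat_diag n (\<lambda>i. complex_of_real (d i))"
  by (intro eq_matI) (auto simp: mat_diag_def)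

lemma cscalar_prod_adjoint:
  fixes A :: "complex mat"
  assumes A: "A \<in> carrier_mat n m" and v: "v \<in> carrier_vec m" and w: "w \<in> carrier_vec n"
  shows "(A *\<^sub>v v) \<bullet>c w = v \<bullet>c (mat_adjoint A *\<^sub>v w)"
proof -
  have "(A *\<^sub>v v) \<bullet>c w = (\<Sum>i<n. \<Sum>j<m. A $$ (i,j) * v $ j * cnj (w $ i))"
    using assms by (auto simp: scalar_prod_def lessThan_atLeast0 sum_distrib_right)
  also have "\<dots> = (\<Sum>j<m. \<Sum>i<n. A $$ (i,j) * v $ j * cnj (w $ i))"
    by (rule sum.swap)
  also have "\<dots> = v \<bullet>c (mat_adjoint A *\<^sub>v w)"
    using assms by (auto simp: scalar_prod_def lessThan_atLeast0 sum_distrib_left mult_ac)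
  finally show ?thesis .
qed

lemma unitary_mat_cancel:
  assumes "U \<in> carrier_mat n n" "unitary_mat U"
  shows "mat_adjoint U * U = 1\<^sub>m n" "U * mat_adjoint U = 1\<^sub>m n"
proof -
  show *: "mat_adjoint U * U = 1\<^sub>m n" using assms unfolding unitary_mat_def by auto
  show "U * mat_adjoint U = 1\<^sub>m n"
    using mat_mult_left_right_inverse[OF _ assms(1) *] assms(1) by auto
qed

lemma unitary_mat_one: "unitary_mat (1\<^sub>m n)"
  unfolding unitary_mat_def by auto

lemma unitary_mat_adjoint:
  assumes "U \<in> carrier_mat n n" "unitary_mat U"
  shows "unitary_mat (mat_adjoint U)"
  using unitary_mat_cancel[OF assms] assms(1) unfolding unitary_mat_def by auto

lemma mult_unitary_cancel:
  fixes A :: "complex mat"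
  assumes "U \<in> carrier_mat n n" "unitary_mat U" "A \<in> carrier_mat n m"
  shows "mat_adjoint U * (U * A) = A" "U * (mat_adjoint U * A) = A"
proof -
  have c: "mat_adjoint U \<in> carrier_mat n n" using assms by simp
  show "mat_adjoint U * (U * A) = A"
    using assoc_mult_mat[OF c assms(1,3)] unitary_mat_cancel(1)[OF assms(1,2)] assms(3) by simp
  show "U * (mat_adjoint U * A) = A"
    using assoc_mult_mat[OF assms(1) c assms(3)] unitary_mat_cancel(2)[OF assms(1,2)] assms(3) by simp
qed

lemma unitary_mat_mult:
  assumes U: "U \<in> carrier_mat n n" "unitary_mat U" and V: "V \<in> carrier_mat n n" "unitary_mat V"
  shows "unitary_mat (U * V)"
proof -
  have c: "mat_adjoint U \<in> carrier_mat n n" "mat_adjoint V \<in> carrier_mat n n"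
    using U V by auto
  have "mat_adjoint (U * V) * (U * V) = mat_adjoint V * (mat_adjoint U * (U * V))"
    using assoc_mult_mat[OF c(2) c(1) mult_carrier_mat[OF U(1) V(1)]] U(1) V(1)
    by (simp add: mat_adjoint_mult)
  also have "\<dots> = 1\<^sub>m n"
    using mult_unitary_cancel(1)[OF U V(1)] unitary_mat_cancel[OF V] by simp
  finally show ?thesis using U(1) V(1) unfolding unitary_mat_def by auto
qed

text \<open>Both orthonormality of columns and deflation by an eigenvector are read off from the entries
  of \<open>W* A W\<close> in this form.\<close>
lemma adjoint_conjugation_index:
  fixes A :: "complex mat"
  assumes A: "A \<in> carrier_mat n n" and W: "W \<in> carrier_mat n n" and i: "i < n" and j: "j < n"
  shows "(mat_adjoint W * A * W) $$ (i, j) = (A *\<^sub>v col W j) \<bullet>c col W i"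
proof -
  have "(mat_adjoint W * A * W) $$ (i, j) = (mat_adjoint W * (A * W)) $$ (i, j)"
    using A W by (simp add: assoc_mult_mat[of _ n n _ n _ n])
  also have "\<dots> = row (mat_adjoint W) i \<bullet> col (A * W) j"
    using A W i j by auto
  also have "col (A * W) j = A *\<^sub>v col W j" using A W i j by auto
  also have "row (mat_adjoint W) i = conjugate (col W i)"
    using W i by (intro eq_vecI) auto
  also have "conjugate (col W i) \<bullet> (A *\<^sub>v col W j) = (A *\<^sub>v col W j) \<bullet>c col W i"
    using A W by (intro comm_scalar_prod[of _ n]) auto
  finally show ?thesis .
qed

text \<open>Completing \<open>v\<close> to a basis and applying Gram-Schmidt gives orthogonal columns starting with \<open>v\<close>;
  dividing each by its norm makes the matrix unitary. This rescales the first column, whence the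
  factor \<open>c\<close>.\<close>
lemma exists_unitary_with_first_col:
  assumes v: "v \<in> carrier_vec n" and v0: "v \<noteq> 0\<^sub>v n"
  shows "\<exists>W c. W \<in> carrier_mat n n \<and> unitary_mat W \<and> col W 0 = c \<cdot>\<^sub>v v"
proof -
  interpret cof_vec_space n "TYPE(complex)" .
  have n: "n \<noteq> 0" using v v0 by auto
  define b where "b = basis_completion v"
  define ws where "ws = gram_schmidt n b"
  from basis_completion[OF v v0, folded b_def]
  have dist_b: "distinct b" and indep: "\<not> lin_dep (set b)" and b: "set b \<subseteq> carrier_vec n"
    and hdb: "hd b = v" and len_b: "length b = n" by auto
  from hdb len_b n obtain vs where bv: "b = v # vs" by (cases b) auto
  from gram_schmidt_result[OF b dist_b indep refl, folded ws_def]
  have ws: "set ws \<subseteq> carrier_vec n" "corthogonal ws" "length ws = n"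
    by (auto simp: len_b)
  from gram_schmidt_hd[OF v, of vs, folded bv] have "hd ws = v" unfolding ws_def .
  hence ws0: "ws ! 0 = v" using ws(3) n by (metis hd_conv_nth length_0_conv)
  have wsc: "ws ! j \<in> carrier_vec n" if "j < n" for j using ws that by auto
  define q where "q j = Re (ws ! j \<bullet>c ws ! j)" for j
  have q: "ws ! j \<bullet>c ws ! j = complex_of_real (q j)" "q j > 0" if "j < n" for j
  proof -
    have "ws ! j \<bullet>c ws ! j \<noteq> 0" using corthogonalD[OF ws(2), of j j] ws(3) that by auto
    moreover have "ws ! j \<bullet>c ws ! j \<ge> 0" by (rule conjugate_square_ge_0_vec)
    ultimately show "ws ! j \<bullet>c ws ! j = complex_of_real (q j)" "q j > 0"
      by (auto simp: q_def less_eq_complex_def complex_eq_iff)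
  qed
  define W where "W = mat n n (\<lambda>(i, j). complex_of_real (1 / sqrt (q j)) * (ws ! j) $ i)"
  have W: "W \<in> carrier_mat n n" by (auto simp: W_def)
  have colW: "col W j = complex_of_real (1 / sqrt (q j)) \<cdot>\<^sub>v (ws ! j)" if "j < n" for j
    using wsc[OF that] that by (intro eq_vecI) (auto simp: W_def)
  have "mat_adjoint W * W = 1\<^sub>m n"
  proof (rule eq_matI)
    fix i j assume "i < dim_row (1\<^sub>m n :: complex mat)" "j < dim_col (1\<^sub>m n :: complex mat)"
    hence i: "i < n" and j: "j < n" by auto
    have "(mat_adjoint W * W) $$ (i, j) = (mat_adjoint W * 1\<^sub>m n * W) $$ (i, j)"
      using W by (metis mat_adjoint_carrier right_mult_one_mat)
    also have "\<dots> = (1\<^sub>m n *\<^sub>v col W j) \<bullet>c col W i"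
      by (rule adjoint_conjugation_index[OF one_carrier_mat W i j])
    also have "\<dots> = complex_of_real (1 / sqrt (q j)) * complex_of_real (1 / sqrt (q i)) * (ws ! j \<bullet>c ws ! i)"
      using wsc[OF i] wsc[OF j] by (simp add: colW i j conjugate_smult_vec)
    also have "\<dots> = (if i = j then 1 else 0)"
    proof (cases "i = j")
      case True
      have "sqrt (q j) * sqrt (q j) = q j" using q(2)[OF j] by simp
      hence "complex_of_real (1 / sqrt (q j)) * complex_of_real (1 / sqrt (q j)) * complex_of_real (q j) = 1"
        using q(2)[OF j] unfolding of_real_mult[symmetric] by (simp add: field_simps)
      thus ?thesis using True q(1)[OF j] by simp
    next
      case False
      thus ?thesis using corthogonalD[OF ws(2), of j i] ws(3) i j by auto
    qed
    finally show "(mat_adjoint W * W) $$ (i, j) = 1\<^sub>m n $$ (i, j)" using i j by simp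
  qed (use W in auto)
  hence "unitary_mat W" using W unfolding unitary_mat_def by auto
  moreover have "col W 0 = complex_of_real (1 / sqrt (q 0)) \<cdot>\<^sub>v v"
    using colW[of 0] ws0 n by simp
  ultimately show ?thesis using W by blast
qed

section \<open>Matrices in spectral form and the spectral calculus\<close>

definition spectral_mat :: "nat \<Rightarrow> complex mat \<Rightarrow> (nat \<Rightarrow> real) \<Rightarrow> complex mat" where
  "spectral_mat n U d = U * mat_diag n (\<lambda>i. complex_of_real (d i)) * mat_adjoint U"

lemma spectral_mat_carrier [simp]:
  "U \<in> carrier_mat n n \<Longrightarrow> spectral_mat n U d \<in> carrier_mat n n"
  unfolding spectral_mat_def by (intro mult_carrier_mat[of _ n n]) auto

lemma mat_diag_cong: "(\<And>i. i < n \<Longrightarrow> f i = g i) \<Longrightarrow> mat_diag n f = mat_diag n g"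
  unfolding mat_diag_def by (intro eq_matI) auto

lemma spectral_mat_cong:
  "(\<And>i. i < n \<Longrightarrow> d i = e i) \<Longrightarrow> spectral_mat n U d = spectral_mat n U e"
  unfolding spectral_mat_def by (simp cong: mat_diag_cong)

lemma spectral_mat_adjoint [simp]:
  assumes "U \<in> carrier_mat n n"
  shows "mat_adjoint (spectral_mat n U d) = spectral_mat n U d"
proof -
  let ?D = "mat_diag n (\<lambda>i. complex_of_real (d i))"
  have c: "mat_adjoint U \<in> carrier_mat n n" using assms by simp
  have UD: "U * ?D \<in> carrier_mat n n" using assms by (intro mult_carrier_mat[of _ n n]) auto
  have "mat_adjoint (spectral_mat n U d) = U * (?D * mat_adjoint U)"
    unfolding spectral_mat_def using mat_adjoint_mult[OF UD c] mat_adjoint_mult[OF assms mat_diag_dim]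
    by simp
  thus ?thesis unfolding spectral_mat_def using assoc_mult_mat[OF assms mat_diag_dim c] by simp
qed

lemma spectral_mat_mult:
  assumes "U \<in> carrier_mat n n" "unitary_mat U"
  shows "spectral_mat n U d * spectral_mat n U e = spectral_mat n U (\<lambda>i. d i * e i)"
proof -
  let ?D = "mat_diag n (\<lambda>i. complex_of_real (d i))"
  let ?E = "mat_diag n (\<lambda>i. complex_of_real (e i))"
  have c: "mat_adjoint U \<in> carrier_mat n n" using assms by simp
  have EU: "?E * mat_adjoint U \<in> carrier_mat n n" using c by (intro mult_carrier_mat[of _ n n]) auto
  have UD: "U * ?D \<in> carrier_mat n n" using assms by (intro mult_carrier_mat[of _ n n]) auto
  have "spectral_mat n U d * spectral_mat n U e = (U * ?D) * mat_adjoint U * (U * (?E * mat_adjoint U))"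
    unfolding spectral_mat_def using assoc_mult_mat[OF assms(1) mat_diag_dim c] by simp
  also have "\<dots> = U * ?D * (mat_adjoint U * (U * (?E * mat_adjoint U)))"
    by (rule assoc_mult_mat[OF UD c mult_carrier_mat[OF assms(1) EU]])
  also have "\<dots> = U * ?D * (?E * mat_adjoint U)" using mult_unitary_cancel(1)[OF assms EU] by simp
  also have "\<dots> = U * ?D * ?E * mat_adjoint U"
    by (rule assoc_mult_mat[symmetric, OF UD mat_diag_dim c])
  also have "U * ?D * ?E = U * (?D * ?E)" by (rule assoc_mult_mat[OF assms(1) mat_diag_dim mat_diag_dim])
  finally show ?thesis unfolding spectral_mat_def by simp
qed

lemma spectral_mat_const_one:
  assumes "U \<in> carrier_mat n n" "unitary_mat U"
  shows "spectral_mat n U (\<lambda>_. 1) = 1\<^sub>m n"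
  using unitary_mat_cancel[OF assms] assms unfolding spectral_mat_def by simp

lemma spectral_mat_pow:
  assumes "U \<in> carrier_mat n n" "unitary_mat U"
  shows "spectral_mat n U d ^\<^sub>m k = spectral_mat n U (\<lambda>i. d i ^ k)"
proof (induction k)
  case 0
  show ?case using spectral_mat_const_one[OF assms] spectral_mat_carrier[OF assms(1), of d] by simp
next
  case (Suc k)
  thus ?case by (simp add: spectral_mat_mult[OF assms] mult.commute)
qed

lemma spectral_mat_one:
  "spectral_mat n (1\<^sub>m n) d = mat_diag n (\<lambda>i. complex_of_real (d i))"
  unfolding spectral_mat_def by (metis mat_adjoint_one mat_diag_dim left_mult_one_mat right_mult_one_mat)

lemma adjoint_conjugation_spectral_mat:
  assumes "U \<in> carrier_mat n n" "unitary_mat U"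
  shows "mat_adjoint U * spectral_mat n U d * U = mat_diag n (\<lambda>i. complex_of_real (d i))"
proof -
  let ?D = "mat_diag n (\<lambda>i. complex_of_real (d i))"
  have c: "mat_adjoint U \<in> carrier_mat n n" using assms by simp
  have D: "?D \<in> carrier_mat n n" by simp
  have UDU: "spectral_mat n U d = U * (?D * mat_adjoint U)"
    unfolding spectral_mat_def by (rule assoc_mult_mat[OF assms(1) D c])
  have "mat_adjoint U * spectral_mat n U d = ?D * mat_adjoint U"
    unfolding UDU by (rule mult_unitary_cancel(1)[OF assms mult_carrier_mat[OF D c]])
  hence "mat_adjoint U * spectral_mat n U d * U = ?D * (mat_adjoint U * U)"
    using assoc_mult_mat[OF D c assms(1)] by simp
  thus ?thesis using unitary_mat_cancel(1)[OF assms] D by simp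
qed

text \<open>The hypothesis says that \<open>W\<close> has a nonzero entry at \<open>(i, j)\<close> only where \<open>d j = e i\<close>, and there also
  \<open>f (d j) = f (e i)\<close>.\<close>
lemma mat_diag_intertwine:
  fixes W :: "complex mat"
  assumes W: "W \<in> carrier_mat n n"
    and eq: "W * mat_diag n (\<lambda>i. complex_of_real (d i)) = mat_diag n (\<lambda>i. complex_of_real (e i)) * W"
  shows "W * mat_diag n (\<lambda>i. complex_of_real (f (d i))) = mat_diag n (\<lambda>i. complex_of_real (f (e i))) * W"
proof -
  have "W $$ (i, j) * complex_of_real (f (d j)) = complex_of_real (f (e i)) * W $$ (i, j)"
    if ij: "i < n" "j < n" for i j
  proof (cases "W $$ (i, j) = 0")
    case False
    have "W $$ (i, j) * complex_of_real (d j) = complex_of_real (e i) * W $$ (i, j)"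
      using arg_cong[OF eq, of "\<lambda>M. M $$ (i, j)"] ij
      by (simp add: mat_diag_mult_left[OF W] mat_diag_mult_right[OF W])
    hence "d j = e i" using False by (simp add: mult.commute[of _ "W $$ (i, j)"])
    thus ?thesis by simp
  qed simp
  thus ?thesis unfolding mat_diag_mult_left[OF W] mat_diag_mult_right[OF W]
    by (intro eq_matI) auto
qed

text \<open>The unitary \<open>V* U\<close> intertwines the two diagonal matrices, hence also their images under \<open>f\<close>.
  This makes the definite description in the spectral calculus proper.\<close>
lemma spectral_mat_unique:
  assumes U: "U \<in> carrier_mat n n" "unitary_mat U" and V: "V \<in> carrier_mat n n" "unitary_mat V"
    and eq: "spectral_mat n U d = spectral_mat n V e"
  shows "spectral_mat n U (\<lambda>i. f (d i)) = spectral_mat n V (\<lambda>i. f (e i))"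
proof -
  define W where "W = mat_adjoint V * U"
  have cU: "mat_adjoint U \<in> carrier_mat n n" and cV: "mat_adjoint V \<in> carrier_mat n n"
    using U V by auto
  have W: "W \<in> carrier_mat n n" unfolding W_def using cV U(1) by auto
  have VW: "V * W = U" unfolding W_def by (rule mult_unitary_cancel(2)[OF V U(1)])
  have WU: "W * mat_adjoint U = mat_adjoint V" unfolding W_def
    using assoc_mult_mat[OF cV U(1) cU] unitary_mat_cancel(2)[OF U] right_mult_one_mat[OF cV] by simp
  have left: "mat_adjoint V * spectral_mat n U g * U = W * mat_diag n (\<lambda>i. complex_of_real (g i))" for g
  proof -
    let ?D = "mat_diag n (\<lambda>i. complex_of_real (g i))"
    have D: "?D \<in> carrier_mat n n" by simp
    have 1: "mat_adjoint V * spectral_mat n U g = W * (?D * mat_adjoint U)"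
      unfolding W_def spectral_mat_def
      using assoc_mult_mat[OF cV U(1) mult_carrier_mat[OF D cU]] assoc_mult_mat[OF U(1) D cU] by simp
    show ?thesis unfolding 1
      using assoc_mult_mat[OF W mult_carrier_mat[OF D cU] U(1)] assoc_mult_mat[OF D cU U(1)]
        unitary_mat_cancel(1)[OF U] D by simp
  qed
  have right: "mat_adjoint V * spectral_mat n V g * U = mat_diag n (\<lambda>i. complex_of_real (g i)) * W" for g
  proof -
    let ?D = "mat_diag n (\<lambda>i. complex_of_real (g i))"
    have D: "?D \<in> carrier_mat n n" by simp
    have 1: "mat_adjoint V * spectral_mat n V g = ?D * mat_adjoint V"
      unfolding spectral_mat_def
      using mult_unitary_cancel(1)[OF V mult_carrier_mat[OF D cV]] assoc_mult_mat[OF V(1) D cV] by simp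
    show ?thesis unfolding 1 W_def
      using assoc_mult_mat[OF D cV U(1)] by simp
  qed
  have "W * mat_diag n (\<lambda>i. complex_of_real (d i)) = mat_diag n (\<lambda>i. complex_of_real (e i)) * W"
    using left[of d] right[of e] eq by simp
  from mat_diag_intertwine[OF W this, of f]
  have *: "W * mat_diag n (\<lambda>i. complex_of_real (f (d i))) = mat_diag n (\<lambda>i. complex_of_real (f (e i))) * W" .
  let ?D = "mat_diag n (\<lambda>i. complex_of_real (f (d i)))"
  let ?E = "mat_diag n (\<lambda>i. complex_of_real (f (e i)))"
  have D: "?D \<in> carrier_mat n n" and E: "?E \<in> carrier_mat n n" by auto
  have "spectral_mat n U (\<lambda>i. f (d i)) = V * (W * ?D) * mat_adjoint U"
    unfolding spectral_mat_def using VW assoc_mult_mat[OF V(1) W D] by simp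
  also have "\<dots> = V * (?E * W) * mat_adjoint U" using * by simp
  also have "\<dots> = V * ?E * W * mat_adjoint U" using assoc_mult_mat[OF V(1) E W] by simp
  also have "\<dots> = V * ?E * (W * mat_adjoint U)"
    by (rule assoc_mult_mat[OF mult_carrier_mat[OF V(1) E] W cU])
  finally show ?thesis unfolding WU spectral_mat_def by simp
qed

lemma spectral_calculus_spectral_mat:
  assumes U: "U \<in> carrier_mat n n" "unitary_mat U"
  shows "spectral_calculus f (spectral_mat n U d) = spectral_mat n U (\<lambda>i. f (d i))"
proof -
  have n: "dim_row (spectral_mat n U d) = n" using spectral_mat_carrier[OF U(1)] by auto
  show ?thesis unfolding spectral_calculus_def n spectral_mat_def[symmetric]
    by (rule the_equality) (use U spectral_mat_unique in metis)+
qed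

lemma psd_powr_spectral_mat:
  assumes "U \<in> carrier_mat n n" "unitary_mat U"
  shows "psd_powr (spectral_mat n U d) p = spectral_mat n U (\<lambda>i. if p = 0 then 1 else d i powr p)"
  unfolding psd_powr_def by (rule spectral_calculus_spectral_mat[OF assms])

text \<open>The eigenvalue \<open>d i\<close> is the quadratic form evaluated at the unit vector \<open>col U i\<close>.\<close>
lemma psd_spectral_mat_nonneg:
  assumes U: "U \<in> carrier_mat n n" "unitary_mat U" and psd: "psd_mat (spectral_mat n U d)" and i: "i < n"
  shows "d i \<ge> 0"
proof -
  let ?A = "spectral_mat n U d"
  have A: "?A \<in> carrier_mat n n" using U by simp
  have "complex_of_real (d i) = (?A *\<^sub>v col U i) \<bullet>c col U i"
    using adjoint_conjugation_index[OF A U(1) i i] i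
    unfolding adjoint_conjugation_spectral_mat[OF U] by (simp add: mat_diag_def)
  also have "\<dots> \<ge> 0" using psd A U(1) unfolding psd_mat_def by auto
  finally show ?thesis by (simp add: less_eq_complex_def)
qed

section \<open>Unitary diagonalization with a prescribed order of the eigenvalues\<close>

text \<open>Induction on the list of eigenvalues, by deflation. A unitary \<open>W\<close> whose first column is an
  eigenvector for the first entry \<open>e\<close> makes the first column of \<open>W* A W\<close> equal to \<open>e\<close> times a
  unit vector; by hermiticity the first row is so too. What remains is a hermitian block whose
  characteristic polynomial is the product over the rest of the list. The order of \<open>es\<close> is
  arbitrary, so the eigenvalues can be sorted by sorting the list.\<close>
lemma hermitian_diagonalization:
  assumes "A \<in> carrier_mat n n" "mat_adjoint A = A" "char_poly A = (\<Prod>e\<leftarrow>es. [:- e, 1:])"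
  shows "\<exists>U \<in> carrier_mat n n. unitary_mat U \<and> A = U * mat_diag n (\<lambda>i. es ! i) * mat_adjoint U"
  using assms
proof (induction es arbitrary: n A)
  case Nil
  with degree_monic_char_poly[of A n] have "n = 0" by simp
  thus ?case using Nil.prems(1) unitary_mat_one[of 0]
    by (intro bexI[of _ "1\<^sub>m 0"]) (auto intro!: eq_matI)
next
  case (Cons e es)
  note A = Cons.prems(1) and herm = Cons.prems(2)
  have cp: "char_poly A = [: -e, 1 :] * (\<Prod>e \<leftarrow> es. [:- e, 1:])" using Cons.prems(3) by simp
  have mon: "monic (\<Prod>e\<leftarrow> es. [:- e, 1:])" by (rule monic_prod_list) auto
  have "degree (char_poly A) = Suc (degree (\<Prod>e\<leftarrow> es. [:- e, 1:]))" unfolding cp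
    by (subst degree_mult_eq, insert mon, auto)
  then obtain m where n: "n = Suc m" using degree_monic_char_poly[OF A] by metis
  have "eigenvalue A e" unfolding eigenvalue_root_char_poly[OF A] cp by simp
  then obtain v where v: "v \<in> carrier_vec n" "v \<noteq> 0\<^sub>v n" and Av: "A *\<^sub>v v = e \<cdot>\<^sub>v v"
    using A unfolding eigenvalue_def eigenvector_def by auto
  obtain W c where W: "W \<in> carrier_mat n n" "unitary_mat W" and W0: "col W 0 = c \<cdot>\<^sub>v v"
    using exists_unitary_with_first_col[OF v] by blast
  have cW: "mat_adjoint W \<in> carrier_mat n n" using W by simp
  have AW0: "A *\<^sub>v col W 0 = e \<cdot>\<^sub>v col W 0"
    unfolding W0 using A v(1) Av by (simp add: mult_mat_vec smult_smult_assoc mult.commute)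
  define A' where "A' = mat_adjoint W * A * W"
  have A': "A' \<in> carrier_mat n n" unfolding A'_def using W cW A by auto
  have A'_eq: "A' = mat_adjoint W * (A * W)"
    unfolding A'_def by (rule assoc_mult_mat[OF cW A W(1)])
  have A_eq: "A = W * A' * mat_adjoint W"
  proof -
    have "W * A' = A * W" unfolding A'_eq
      using mult_unitary_cancel(2)[OF W mult_carrier_mat[OF A W(1)]] .
    thus ?thesis using assoc_mult_mat[OF A W(1) cW] unitary_mat_cancel(2)[OF W] A by simp
  qed
  have "mat_adjoint A' = mat_adjoint W * (A * W)"
    unfolding A'_def using mat_adjoint_mult[OF mult_carrier_mat[OF cW A] W(1)]
      mat_adjoint_mult[OF cW A] herm by simp
  hence herm': "mat_adjoint A' = A'" by (simp add: A'_eq)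
  have colW: "col W i \<in> carrier_vec n" for i using W(1) by (intro carrier_vecI) auto
  have col0: "A' $$ (i, 0) = (if i = 0 then e else 0)" if i: "i < n" for i
  proof -
    have "A' $$ (i, 0) = (e \<cdot>\<^sub>v col W 0) \<bullet>c col W i"
      unfolding A'_def AW0[symmetric] using adjoint_conjugation_index[OF A W(1) i, of 0] n by simp
    also have "\<dots> = e * ((1\<^sub>m n *\<^sub>v col W 0) \<bullet>c col W i)"
      using colW[of 0] colW[of i] by simp
    also have "(1\<^sub>m n *\<^sub>v col W 0) \<bullet>c col W i = (mat_adjoint W * 1\<^sub>m n * W) $$ (i, 0)"
      using adjoint_conjugation_index[OF one_carrier_mat W(1) i, of 0] n by simp
    also have "\<dots> = (if i = 0 then 1 else 0)"
      using unitary_mat_cancel(1)[OF W] right_mult_one_mat[OF cW] i n by simp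
    finally show ?thesis by simp
  qed
  have row0: "A' $$ (0, i) = (if i = 0 then e else 0)" if i: "i < n" for i
  proof (cases "i = 0")
    case False
    have "A' $$ (0, i) = cnj (A' $$ (i, 0))"
      using arg_cong[OF herm', of "\<lambda>M. M $$ (0, i)"] A' i n by simp
    thus ?thesis using col0[OF i] False by simp
  qed (use col0 i in auto)
  define A3 where "A3 = mat m m (\<lambda>(i, j). A' $$ (Suc i, Suc j))"
  have A3: "A3 \<in> carrier_mat m m" unfolding A3_def by simp
  let ?A1 = "mat 1 1 (\<lambda>_. e)"
  have A'_block: "A' = four_block_mat ?A1 (0\<^sub>m 1 m) (0\<^sub>m m 1) A3"
    using A' n col0 row0 by (intro eq_matI) (auto simp: A3_def less_Suc_eq_0_disj)
  have herm3: "mat_adjoint A3 = A3"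
  proof (rule eq_matI)
    fix i j assume "i < dim_row A3" "j < dim_col A3"
    thus "mat_adjoint A3 $$ (i, j) = A3 $$ (i, j)"
      using arg_cong[OF herm', of "\<lambda>M. M $$ (Suc i, Suc j)"] A' n by (simp add: A3_def)
  qed (auto simp: A3_def)
  have sim: "similar_mat A A'"
    unfolding similar_mat_def
    by (intro exI, rule similar_mat_witI[OF _ _ A_eq A A' W(1) cW])
      (use unitary_mat_cancel[OF W] in auto)
  have "char_poly A' = char_poly ?A1 * char_poly A3"
    unfolding A'_block by (rule char_poly_four_block_zeros_col[OF _ _ A3]) auto
  also have "char_poly ?A1 = [: -e,1 :]"
    by (simp add: char_poly_defs det_def sign_def)
  finally have "[: -e,1 :] * char_poly A3 = [: -e,1 :] * (\<Prod>e \<leftarrow> es. [:- e, 1:])"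
    using char_poly_similar[OF sim] cp by simp
  hence "char_poly A3 = (\<Prod>e \<leftarrow> es. [:- e, 1:])"
    by (metis mult_cancel_left pCons_eq_0_iff zero_neq_one)
  from Cons.IH[OF A3 herm3 this] obtain U where U: "U \<in> carrier_mat m m" "unitary_mat U"
    and A3_eq: "A3 = U * mat_diag m (\<lambda>i. es ! i) * mat_adjoint U" by blast
  have cU: "mat_adjoint U \<in> carrier_mat m m" using U by simp
  let ?D = "mat_diag m (\<lambda>i. es ! i)"
  let ?D' = "mat_diag n (\<lambda>i. (e # es) ! i)"
  define F where "F = four_block_mat (1\<^sub>m 1) (0\<^sub>m 1 m) (0\<^sub>m m 1) U"
  have F: "F \<in> carrier_mat n n" unfolding F_def n using four_block_carrier_mat[OF one_carrier_mat[of 1] U(1)] by simp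
  have adjF: "mat_adjoint F = four_block_mat (1\<^sub>m 1) (0\<^sub>m 1 m) (0\<^sub>m m 1) (mat_adjoint U)"
    unfolding F_def using U(1) by (intro eq_matI) auto
  have "mat_adjoint F * F = 1\<^sub>m n"
    unfolding adjF unfolding F_def n
    using mult_four_block_mat[OF one_carrier_mat[of 1] zero_carrier_mat zero_carrier_mat cU
        one_carrier_mat zero_carrier_mat zero_carrier_mat U(1)]
      unitary_mat_cancel(1)[OF U] U(1) cU by simp
  hence uF: "unitary_mat F" using F unfolding unitary_mat_def by auto
  have D': "?D' = four_block_mat ?A1 (0\<^sub>m 1 m) (0\<^sub>m m 1) ?D"
    unfolding n mat_diag_def by (intro eq_matI) (auto simp: less_Suc_eq_0_disj)
  have A1: "?A1 \<in> carrier_mat 1 1" by simp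
  have FD: "F * ?D' = four_block_mat ?A1 (0\<^sub>m 1 m) (0\<^sub>m m 1) (U * ?D)"
    unfolding F_def D'
    using mult_four_block_mat[OF one_carrier_mat zero_carrier_mat zero_carrier_mat U(1)
        A1 zero_carrier_mat zero_carrier_mat mat_diag_dim] U(1) A1
      mult_carrier_mat[OF U(1) mat_diag_dim]
      by (simp add: left_mult_zero_mat[OF mat_diag_dim])
  have "F * ?D' * mat_adjoint F = A'"
    unfolding FD adjF A'_block A3_eq
    using mult_four_block_mat[OF A1 zero_carrier_mat zero_carrier_mat mult_carrier_mat[OF U(1) mat_diag_dim]
        one_carrier_mat zero_carrier_mat zero_carrier_mat cU] U(1) A1 cU
      mult_carrier_mat[OF mult_carrier_mat[OF U(1) mat_diag_dim] cU]
      mult_carrier_mat[OF U(1) mat_diag_dim]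
      by (simp add: left_mult_zero_mat[OF cU]
          right_mult_zero_mat[OF mult_carrier_mat[OF U(1) mat_diag_dim]])
  hence "A = W * (F * ?D' * mat_adjoint F) * mat_adjoint W" using A_eq by simp
  also have "\<dots> = W * F * ?D' * (mat_adjoint F * mat_adjoint W)"
  proof -
    have cF: "mat_adjoint F \<in> carrier_mat n n" using F by simp
    have D: "?D' \<in> carrier_mat n n" by simp
    note FD = mult_carrier_mat[OF F D]
    have "W * (F * ?D' * mat_adjoint F) * mat_adjoint W = W * (F * ?D' * (mat_adjoint F * mat_adjoint W))"
      using assoc_mult_mat[OF W(1) mult_carrier_mat[OF FD cF] cW] assoc_mult_mat[OF FD cF cW] by simp
    also have "\<dots> = W * (F * ?D') * (mat_adjoint F * mat_adjoint W)"
      using assoc_mult_mat[OF W(1) FD mult_carrier_mat[OF cF cW]] by simp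
    finally show ?thesis using assoc_mult_mat[OF W(1) F D] by simp
  qed
  finally have "A = W * F * ?D' * mat_adjoint (W * F)" using mat_adjoint_mult[OF W(1) F] by simp
  thus ?case using unitary_mat_mult[OF W F uF] mult_carrier_mat[OF W(1) F] by blast
qed

section \<open>Sorted eigenvalues and singular values\<close>

text \<open>A first diagonalization, in an arbitrary order, shows that the eigenvalues are nonnegative and
  that \<open>|A| = (A\<^sup>2)\<^sup>1\<^sup>/\<^sup>2 = A\<close>, so the singular values are the sorted roots of the characteristic polynomial
  of \<open>A\<close> itself. Diagonalizing again along the sorted list gives the claim.\<close>
lemma psd_sorted_diagonalization:
  assumes A: "A \<in> carrier_mat n n" and psd: "psd_mat A"
  shows "\<exists>U \<in> carrier_mat n n. unitary_mat U \<and> A = spectral_mat n U (\<lambda>i. singular_values A ! i)"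
    and "length (singular_values A) = n"
    and "sorted_wrt (\<ge>) (singular_values A)"
    and "\<forall>x \<in> set (singular_values A). x \<ge> 0"
proof -
  let ?sv = "singular_values A"
  have herm: "mat_adjoint A = A" using psd unfolding psd_mat_def hermitian_mat_def by simp
  obtain as where as: "char_poly A = (\<Prod>a\<leftarrow>as. [:- a, 1:])" and len: "length as = n"
    using char_poly_factorized[OF A] by blast
  obtain U where U: "U \<in> carrier_mat n n" "unitary_mat U"
    and A_eq: "A = U * mat_diag n (\<lambda>i. as ! i) * mat_adjoint U"
    using hermitian_diagonalization[OF A herm as] by blast
  have cU: "mat_adjoint U \<in> carrier_mat n n" using U by simp
  let ?D = "mat_diag n (\<lambda>i. as ! i)"
  have D_eq: "?D = mat_adjoint U * A * U"
  proof -
    have D: "?D \<in> carrier_mat n n" by simp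
    have "mat_adjoint U * A = ?D * mat_adjoint U"
      unfolding A_eq assoc_mult_mat[OF U(1) D cU]
      by (rule mult_unitary_cancel(1)[OF U mult_carrier_mat[OF D cU]])
    thus ?thesis
      using assoc_mult_mat[OF D cU U(1)] unitary_mat_cancel(1)[OF U] right_mult_one_mat[OF D] by simp
  qed
  have as_real: "as ! i = complex_of_real (Re (as ! i))" if i: "i < n" for i
  proof -
    have "as ! i = (A *\<^sub>v col U i) \<bullet>c col U i"
      using adjoint_conjugation_index[OF A U(1) i i] i unfolding D_eq[symmetric]
      by (simp add: mat_diag_def)
    also have "\<dots> \<ge> 0" using psd A U(1) unfolding psd_mat_def by auto
    finally show ?thesis by (simp add: less_eq_complex_def complex_eq_iff)
  qed
  have A_spec: "A = spectral_mat n U (\<lambda>i. Re (as ! i))"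
    unfolding spectral_mat_def using A_eq as_real by (simp cong: mat_diag_cong)
  have nonneg: "Re (as ! i) \<ge> 0" if "i < n" for i
    using psd_spectral_mat_nonneg[OF U, of "\<lambda>i. Re (as ! i)"] psd that A_spec by simp
  have "mat_adjoint A * A = spectral_mat n U (\<lambda>i. Re (as ! i) * Re (as ! i))"
    unfolding herm by (subst (1 2) A_spec) (rule spectral_mat_mult[OF U])
  hence "mat_abs A = spectral_mat n U (\<lambda>i. (Re (as ! i) * Re (as ! i)) powr (1/2))"
    unfolding mat_abs_def using psd_powr_spectral_mat[OF U] by simp
  also have "\<dots> = spectral_mat n U (\<lambda>i. Re (as ! i))"
    by (rule spectral_mat_cong) (simp add: nonneg powr_half_sqrt)
  finally have abs: "mat_abs A = A" using A_spec by simp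
  have "proots (char_poly A) = mset as"
  proof -
    have "proots (\<Prod>p\<leftarrow>map (\<lambda>a. [:- a, 1:]) as. p) = (\<Sum>p\<leftarrow>map (\<lambda>a. [:- a, 1:]) as. proots p)"
      by (rule proots_prod_list) auto
    also have "\<dots> = mset as" by (induction as) (auto simp: o_def)
    finally show ?thesis by (simp add: as)
  qed
  hence sv: "?sv = rev (sorted_list_of_multiset (mset (map Re as)))"
    unfolding singular_values_def abs by simp
  have mset_sv: "mset ?sv = mset (map Re as)" unfolding sv by simp
  show "length ?sv = n" using mset_eq_length[OF mset_sv] len by simp
  show "sorted_wrt (\<ge>) ?sv" unfolding sv sorted_wrt_rev by simp
  show "\<forall>x \<in> set ?sv. x \<ge> 0"
    using mset_eq_setD[OF mset_sv] nonneg len by (auto simp: in_set_conv_nth)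
  have "mset (map complex_of_real ?sv) = mset (map complex_of_real (map Re as))"
    using mset_sv by (metis mset_map)
  also have "map complex_of_real (map Re as) = as"
    by (rule nth_equalityI) (use as_real len in auto)
  finally have "mset (map (\<lambda>a. [:- a, 1:]) (map complex_of_real ?sv)) = mset (map (\<lambda>a. [:- a, 1:]) as)"
    by (metis mset_map)
  hence "char_poly A = (\<Prod>a\<leftarrow>map complex_of_real ?sv. [:- a, 1:])"
    unfolding as by (metis prod_mset_prod_list)
  from hermitian_diagonalization[OF A herm this] obtain V where
    V: "V \<in> carrier_mat n n" "unitary_mat V"
    "A = V * mat_diag n (\<lambda>i. map complex_of_real ?sv ! i) * mat_adjoint V" by blast
  moreover have "mat_diag n (\<lambda>i. map complex_of_real ?sv ! i) = mat_diag n (\<lambda>i. complex_of_real (?sv ! i))"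
    by (rule mat_diag_cong) (simp add: \<open>length ?sv = n\<close>)
  ultimately show "\<exists>U \<in> carrier_mat n n. unitary_mat U \<and> A = spectral_mat n U (\<lambda>i. ?sv ! i)"
    unfolding spectral_mat_def by auto
qed

section \<open>Traces\<close>

lemma mat_trace_comm:
  assumes "A \<in> carrier_mat n m" "B \<in> carrier_mat m n"
  shows "mat_trace (A * B) = mat_trace (B * A)"
proof -
  have "mat_trace (A * B) = (\<Sum>i<n. \<Sum>j<m. A $$ (i, j) * B $$ (j, i))"
    using assms by (simp add: mat_trace_def scalar_prod_def lessThan_atLeast0)
  also have "\<dots> = (\<Sum>j<m. \<Sum>i<n. A $$ (i, j) * B $$ (j, i))" by (rule sum.swap)
  also have "\<dots> = mat_trace (B * A)"
    using assms by (simp add: mat_trace_def scalar_prod_def lessThan_atLeast0 mult.commute)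
  finally show ?thesis .
qed

lemma mat_trace_adjoint:
  "A \<in> carrier_mat n n \<Longrightarrow> mat_trace (mat_adjoint A) = cnj (mat_trace A)"
  by (simp add: mat_trace_def)

lemma mat_trace_mult_mat_diag:
  assumes P: "P \<in> carrier_mat n n" and Q: "Q \<in> carrier_mat n n"
  shows "mat_trace (P * mat_diag n f * Q) = (\<Sum>i<n. f i * (Q * P) $$ (i, i))"
proof -
  have D: "mat_diag n f \<in> carrier_mat n n" by simp
  have "mat_trace (P * mat_diag n f * Q) = mat_trace (mat_diag n f * (Q * P))"
    using mat_trace_comm[OF P mult_carrier_mat[OF D Q]] assoc_mult_mat[OF P D Q] assoc_mult_mat[OF D Q P]
    by simp
  also have "\<dots> = (\<Sum>i<n. f i * (Q * P) $$ (i, i))"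
    unfolding mat_diag_mult_left[OF mult_carrier_mat[OF Q P]] mat_trace_def by simp
  finally show ?thesis .
qed

section \<open>Contractions and coordinate projections\<close>

definition contraction :: "nat \<Rightarrow> complex mat \<Rightarrow> bool" where
  "contraction n K \<longleftrightarrow> K \<in> carrier_mat n n \<and>
     (\<forall>v \<in> carrier_vec n. (K *\<^sub>v v) \<bullet>c (K *\<^sub>v v) \<le> v \<bullet>c v)"

lemma contraction_carrier: "contraction n K \<Longrightarrow> K \<in> carrier_mat n n"
  unfolding contraction_def by simp

lemma contraction_mult:
  assumes "contraction n K" "contraction n L"
  shows "contraction n (K * L)"
  unfolding contraction_def
proof (intro conjI ballI)
  have K: "K \<in> carrier_mat n n" and L: "L \<in> carrier_mat n n" using assms contraction_carrier by auto
  thus "K * L \<in> carrier_mat n n" by simp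
  fix v :: "complex vec" assume v: "v \<in> carrier_vec n"
  have "(K *\<^sub>v (L *\<^sub>v v)) \<bullet>c (K *\<^sub>v (L *\<^sub>v v)) \<le> (L *\<^sub>v v) \<bullet>c (L *\<^sub>v v)"
    using assms(1) L v unfolding contraction_def by auto
  also have "\<dots> \<le> v \<bullet>c v" using assms(2) v unfolding contraction_def by auto
  finally show "(K * L *\<^sub>v v) \<bullet>c (K * L *\<^sub>v v) \<le> v \<bullet>c v"
    using K L v by simp
qed

lemma contraction_unitary:
  assumes U: "U \<in> carrier_mat n n" "unitary_mat U"
  shows "contraction n U"
proof -
  have "(U *\<^sub>v v) \<bullet>c (U *\<^sub>v v) = v \<bullet>c v" if v: "v \<in> carrier_vec n" for v
  proof -
    have "(U *\<^sub>v v) \<bullet>c (U *\<^sub>v v) = v \<bullet>c (mat_adjoint U *\<^sub>v (U *\<^sub>v v))"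
      using U v by (intro cscalar_prod_adjoint) auto
    also have "mat_adjoint U *\<^sub>v (U *\<^sub>v v) = v"
      using assoc_mult_mat_vec[OF mat_adjoint_carrier[OF U(1)] U(1) v] unitary_mat_cancel(1)[OF U] v
      by simp
    finally show ?thesis .
  qed
  thus ?thesis using U unfolding contraction_def by simp
qed

definition cut_mat :: "nat \<Rightarrow> nat \<Rightarrow> complex mat" where
  "cut_mat n k = mat_diag n (\<lambda>i. if i < k then 1 else 0)"

lemma cut_mat_carrier [simp]: "cut_mat n k \<in> carrier_mat n n"
  unfolding cut_mat_def by simp

lemma cut_mat_full: "cut_mat n n = 1\<^sub>m n"
  unfolding cut_mat_def mat_diag_one[symmetric] by (rule mat_diag_cong) simp

lemma contraction_cut_mat: "contraction n (cut_mat n k)"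
  unfolding contraction_def
proof (intro conjI ballI)
  fix v :: "complex vec" assume v: "v \<in> carrier_vec n"
  have cut_v: "cut_mat n k *\<^sub>v v = vec n (\<lambda>i. if i < k then v $ i else 0)"
    using v by (intro eq_vecI) (auto simp: cut_mat_def mat_diag_def scalar_prod_def if_distrib[of "\<lambda>x. x * _"]
      sum.delta cong: if_cong)
  have "(\<Sum>i\<in>{0..<n}. (if i < k then v $ i else 0) * cnj (if i < k then v $ i else 0))
      \<le> (\<Sum>i\<in>{0..<n}. v $ i * cnj (v $ i))"
    by (rule sum_mono) (auto simp: conjugate_square_positive[where 'a = complex, simplified])
  thus "(cut_mat n k *\<^sub>v v) \<bullet>c (cut_mat n k *\<^sub>v v) \<le> v \<bullet>c v"
    unfolding cut_v using v by (simp add: scalar_prod_def)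
qed simp

text \<open>The \<open>i\<close>-th column of \<open>K\<close> is the image of a unit vector, so its norm is at most one.\<close>
lemma contraction_diagonal_le_1:
  assumes K: "contraction n K" and i: "i < n"
  shows "cmod (K $$ (i, i)) \<le> 1"
proof -
  have c: "K \<in> carrier_mat n n" using K contraction_carrier by auto
  have col: "K *\<^sub>v unit_vec n i = col K i"
    using c i by (intro eq_vecI) auto
  have "K $$ (i, i) * cnj (K $$ (i, i)) \<le> (\<Sum>j\<in>{0..<n}. K $$ (j, i) * cnj (K $$ (j, i)))"
    using i conjugate_square_positive[where 'a = complex] by (intro member_le_sum) auto
  also have "\<dots> = (K *\<^sub>v unit_vec n i) \<bullet>c (K *\<^sub>v unit_vec n i)"
    unfolding col using c i by (simp add: scalar_prod_def)
  also have "\<dots> \<le> unit_vec n i \<bullet>c unit_vec n i" using K unfolding contraction_def by simp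
  also have "\<dots> = 1" using i by simp
  finally have "complex_of_real ((cmod (K $$ (i, i)))\<^sup>2) \<le> 1"
    unfolding complex_norm_square .
  hence "(cmod (K $$ (i, i)))\<^sup>2 \<le> 1\<^sup>2" by (simp add: less_eq_complex_def)
  thus ?thesis by (rule power2_le_imp_le) simp
qed

section \<open>The trace inequality for products of positive semidefinite matrices\<close>

text \<open>Summation by parts. If \<open>d n = 0\<close> and \<open>d\<close> is decreasing, this expands \<open>d\<close> into indicators of initial
  segments with the nonnegative weights \<open>d j - d (Suc j)\<close>. It is used below both for complex \<open>g\<close>
  (traces) and for real \<open>g\<close> (bounds).\<close>
lemma sum_by_parts_scaleR:
  fixes g :: "nat \<Rightarrow> 'a :: real_vector"
  shows "(\<Sum>i<n. d i *\<^sub>R g i) = (\<Sum>j<n. (d j - d (Suc j)) *\<^sub>R (\<Sum>i<Suc j. g i)) + d n *\<^sub>R (\<Sum>i<n. g i)"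
  by (induction n) (simp_all add: algebra_simps)

text \<open>The quantification over \<open>K\<close>, \<open>L\<close> and \<open>k\<close> is what makes the predicate stable under multiplying \<open>M\<close>
  from the left: a contraction of rank at most \<open>k\<close> is exactly a product \<open>K E\<^sub>k L\<close>, and
  the contractions of bounded rank are closed under products.\<close>
definition trace_dominated :: "nat \<Rightarrow> complex mat \<Rightarrow> (nat \<Rightarrow> real) \<Rightarrow> bool" where
  "trace_dominated n M w \<longleftrightarrow> M \<in> carrier_mat n n \<and>
     (\<forall>K L k. contraction n K \<longrightarrow> contraction n L \<longrightarrow> k \<le> n \<longrightarrow>
        cmod (mat_trace (K * cut_mat n k * L * M)) \<le> (\<Sum>i<k. w i))"

text \<open>Cyclically, \<open>Tr (K E\<^sub>k L)\<close> is the sum of the first \<open>k\<close> diagonal entries of the contraction \<open>L K\<close>.\<close>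
lemma trace_dominated_one: "trace_dominated n (1\<^sub>m n) (\<lambda>_. 1)"
  unfolding trace_dominated_def
proof (intro conjI allI impI)
  fix K L k assume K: "contraction n K" and L: "contraction n L" and k: "k \<le> n"
  have c: "K \<in> carrier_mat n n" "L \<in> carrier_mat n n" using K L contraction_carrier by auto
  have "K * cut_mat n k * L * 1\<^sub>m n = K * cut_mat n k * L"
    using c by (intro right_mult_one_mat[of _ n]) (auto intro!: mult_carrier_mat[of _ n n])
  hence "mat_trace (K * cut_mat n k * L * 1\<^sub>m n) = (\<Sum>i<n. (if i < k then 1 else 0) * (L * K) $$ (i, i))"
    unfolding cut_mat_def using mat_trace_mult_mat_diag[OF c] by simp
  also have "\<dots> = (\<Sum>i\<in>{..<n} \<inter> {i. i < k}. (L * K) $$ (i, i))"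
    by (simp add: sum.inter_filter[symmetric] if_distrib[of "\<lambda>x. x * _"] sum.inter_restrict cong: if_cong)
  also have "{..<n} \<inter> {i. i < k} = {..<k}" using k by auto
  also have "cmod (\<Sum>i<k. (L * K) $$ (i, i)) \<le> (\<Sum>i<k. 1)"
    by (rule sum_norm_le) (use contraction_diagonal_le_1[OF contraction_mult[OF L K]] k in auto)
  finally show "cmod (mat_trace (K * cut_mat n k * L * 1\<^sub>m n)) \<le> (\<Sum>i<k. 1)" .
qed simp

text \<open>Appending the projection \<open>U E\<^sub>l U*\<close> to \<open>K E\<^sub>k L\<close> gives a product of the same shape whose middle
  factor has rank \<open>min k l\<close>: the larger of the two projections is absorbed into a contraction on the
  side where it stands.\<close>
lemma trace_dominated_mult_cut:
  assumes M: "trace_dominated n M w" and U: "U \<in> carrier_mat n n" "unitary_mat U"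
    and K: "contraction n K" and L: "contraction n L" and k: "k \<le> n" and l: "l \<le> n"
  shows "cmod (mat_trace (K * cut_mat n k * L * U * cut_mat n l * (mat_adjoint U * M))) \<le> (\<Sum>i<min k l. w i)"
proof -
  have cK: "K \<in> carrier_mat n n" and cL: "L \<in> carrier_mat n n" using K L contraction_carrier by auto
  have cM: "M \<in> carrier_mat n n" using M unfolding trace_dominated_def by simp
  have cU: "mat_adjoint U \<in> carrier_mat n n" using U by simp
  have uU: "contraction n U" "contraction n (mat_adjoint U)"
    using contraction_unitary[OF U] contraction_unitary[OF cU unitary_mat_adjoint[OF U]] by auto
  let ?E = "cut_mat n k" and ?F = "cut_mat n l"
  have cE: "?E \<in> carrier_mat n n" and cF: "?F \<in> carrier_mat n n" by auto
  have KE: "K * ?E \<in> carrier_mat n n" using mult_carrier_mat[OF cK cE] .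
  have KEL: "K * ?E * L \<in> carrier_mat n n" using mult_carrier_mat[OF KE cL] .
  have LU: "L * U \<in> carrier_mat n n" using mult_carrier_mat[OF cL U(1)] .
  have KELU: "K * ?E * L * U \<in> carrier_mat n n" using mult_carrier_mat[OF KEL U(1)] .
  have eq1: "K * ?E * L * U * ?F * (mat_adjoint U * M) = (K * ?E * L * U) * ?F * mat_adjoint U * M"
    using assoc_mult_mat[OF mult_carrier_mat[OF KELU cF] cU cM] by simp
  show ?thesis
  proof (cases "k \<le> l")
    case True
    have "(K * ?E * L * U) * ?F * mat_adjoint U = K * ?E * (L * U * ?F * mat_adjoint U)"
      using assoc_mult_mat[OF KE cL U(1)] assoc_mult_mat[OF KE LU cF]
        assoc_mult_mat[OF KE mult_carrier_mat[OF LU cF] cU] by simp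
    moreover have "contraction n (L * U * ?F * mat_adjoint U)"
      by (intro contraction_mult L uU contraction_cut_mat)
    ultimately show ?thesis using M K k True unfolding eq1 trace_dominated_def by (auto simp: min_def)
  next
    case False
    have "contraction n (K * ?E * L * U)"
      by (intro contraction_mult K L uU contraction_cut_mat)
    thus ?thesis using M uU l False unfolding eq1 trace_dominated_def by (auto simp: min_def)
  qed
qed

text \<open>The trace is linear in \<open>d\<close>. Summation by parts reduces it to the indicators \<open>d = 1\<close> on \<open>{..<Suc j}\<close>,
  where the preceding lemma bounds it by \<open>\<Sum>i<min k (Suc j). w i\<close>; the same summation by parts, read
  backwards with \<open>w\<close> truncated at \<open>k\<close>, reassembles these bounds into \<open>\<Sum>i<k. d i * w i\<close>.\<close>
lemma trace_dominated_spectral_mult: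
  assumes M: "trace_dominated n M w" and U: "U \<in> carrier_mat n n" "unitary_mat U"
    and dec: "\<And>i j. i \<le> j \<Longrightarrow> j < n \<Longrightarrow> d j \<le> d i" and nonneg: "\<And>i. i < n \<Longrightarrow> 0 \<le> d i"
  shows "trace_dominated n (spectral_mat n U d * M) (\<lambda>i. d i * w i)"
  unfolding trace_dominated_def
proof (intro conjI allI impI)
  have cM: "M \<in> carrier_mat n n" using M unfolding trace_dominated_def by simp
  show "spectral_mat n U d * M \<in> carrier_mat n n"
    by (rule mult_carrier_mat[OF spectral_mat_carrier[OF U(1)] cM])
  fix K L k assume K: "contraction n K" and L: "contraction n L" and k: "k \<le> n"
  have cK: "K \<in> carrier_mat n n" and cL: "L \<in> carrier_mat n n" using K L contraction_carrier by auto
  \<comment> \<open>Setting the sequence to zero from \<open>n\<close> on removes the boundary term of the summation by parts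
    and keeps the last difference nonnegative.\<close>
  define e where "e i = (if i < n then d i else 0)" for i
  have en: "e n = 0" by (simp add: e_def)
  have e_diff: "e j - e (Suc j) \<ge> 0" for j
    using dec[of j "Suc j"] nonneg[of j] by (auto simp: e_def)
  define P where "P = K * cut_mat n k * L * U"
  define Q where "Q = mat_adjoint U * M"
  have cU: "mat_adjoint U \<in> carrier_mat n n" using U by simp
  have KEL: "K * cut_mat n k * L \<in> carrier_mat n n"
    by (intro mult_carrier_mat[of _ n n] cK cL cut_mat_carrier)
  have P: "P \<in> carrier_mat n n" unfolding P_def by (rule mult_carrier_mat[OF KEL U(1)])
  have Q: "Q \<in> carrier_mat n n" unfolding Q_def by (rule mult_carrier_mat[OF cU cM])
  define g where "g i = (Q * P) $$ (i, i)" for i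
  let ?D = "mat_diag n (\<lambda>i. complex_of_real (d i))"
  have D: "?D \<in> carrier_mat n n" by simp
  have "K * cut_mat n k * L * (spectral_mat n U d * M) = P * ?D * Q"
  proof -
    have "spectral_mat n U d * M = U * (?D * Q)"
      unfolding spectral_mat_def Q_def
      using assoc_mult_mat[OF mult_carrier_mat[OF U(1) D] cU cM]
        assoc_mult_mat[OF U(1) D mult_carrier_mat[OF cU cM]] by simp
    thus ?thesis unfolding P_def
      using assoc_mult_mat[OF KEL U(1) mult_carrier_mat[OF D Q]] assoc_mult_mat[OF P D Q]
      unfolding P_def by simp
  qed
  hence "mat_trace (K * cut_mat n k * L * (spectral_mat n U d * M)) = (\<Sum>i<n. complex_of_real (d i) * g i)"
    using mat_trace_mult_mat_diag[OF P Q] by (simp add: g_def)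
  also have "\<dots> = (\<Sum>i<n. e i *\<^sub>R g i)"
    by (rule sum.cong) (auto simp: e_def scaleR_conv_of_real)
  also have "\<dots> = (\<Sum>j<n. (e j - e (Suc j)) *\<^sub>R (\<Sum>i<Suc j. g i))"
    using sum_by_parts_scaleR[of e g n] en by simp
  also have "cmod \<dots> \<le> (\<Sum>j<n. (e j - e (Suc j)) * (\<Sum>i<min k (Suc j). w i))"
  proof (rule sum_norm_le)
    fix j assume j: "j \<in> {..<n}"
    have "(\<Sum>i<Suc j. g i) = (\<Sum>i<n. (if i < Suc j then 1 else 0) * g i)"
      using j by (intro sum.mono_neutral_cong_left) auto
    also have "\<dots> = mat_trace (P * cut_mat n (Suc j) * Q)"
      unfolding cut_mat_def mat_trace_mult_mat_diag[OF P Q] g_def ..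
    also have "cmod \<dots> \<le> (\<Sum>i<min k (Suc j). w i)"
      unfolding P_def Q_def using trace_dominated_mult_cut[OF M U K L k, of "Suc j"] j by simp
    finally show "cmod ((e j - e (Suc j)) *\<^sub>R (\<Sum>i<Suc j. g i)) \<le> (e j - e (Suc j)) * (\<Sum>i<min k (Suc j). w i)"
      using e_diff[of j] by (simp add: mult_left_mono del: sum.lessThan_Suc)
  qed
  also have "\<dots> = (\<Sum>j<n. (e j - e (Suc j)) *\<^sub>R (\<Sum>i<Suc j. if i < k then w i else 0))"
  proof (rule sum.cong[OF refl])
    fix j
    have "(\<Sum>i<min k (Suc j). w i) = (\<Sum>i<Suc j. if i < k then w i else 0)"
      by (intro sum.mono_neutral_cong_left) auto
    thus "(e j - e (Suc j)) * (\<Sum>i<min k (Suc j). w i) = (e j - e (Suc j)) *\<^sub>R (\<Sum>i<Suc j. if i < k then w i else 0)"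
      by simp
  qed
  also have "\<dots> = (\<Sum>i<n. e i *\<^sub>R (if i < k then w i else 0))"
    using sum_by_parts_scaleR[of e "\<lambda>i. if i < k then w i else 0" n] en by simp
  also have "\<dots> = (\<Sum>i<k. d i * w i)"
    using k by (intro sum.mono_neutral_cong_right) (auto simp: e_def)
  finally show "cmod (mat_trace (K * cut_mat n k * L * (spectral_mat n U d * M))) \<le> (\<Sum>i<k. d i * w i)" .
qed

lemma trace_dominated_trace_le:
  assumes "trace_dominated n M w"
  shows "cmod (mat_trace M) \<le> (\<Sum>i<n. w i)"
proof -
  have M: "M \<in> carrier_mat n n" using assms unfolding trace_dominated_def by simp
  have one: "contraction n (1\<^sub>m n)" using contraction_unitary[OF _ unitary_mat_one] by simp
  have "cmod (mat_trace (1\<^sub>m n * cut_mat n n * 1\<^sub>m n * M)) \<le> (\<Sum>i<n. w i)"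
    using assms one unfolding trace_dominated_def by blast
  thus ?thesis using M by (simp add: cut_mat_full)
qed

lemma trace_dominated_pow_mult:
  assumes U: "U \<in> carrier_mat n n" "unitary_mat U" and V: "V \<in> carrier_mat n n" "unitary_mat V"
    and a: "\<And>i j. i \<le> j \<Longrightarrow> j < n \<Longrightarrow> a j \<le> a i" "\<And>i. i < n \<Longrightarrow> 0 \<le> a i"
    and b: "\<And>i j. i \<le> j \<Longrightarrow> j < n \<Longrightarrow> b j \<le> b i" "\<And>i. i < n \<Longrightarrow> 0 \<le> b i"
    and M: "trace_dominated n M w"
  shows "trace_dominated n ((spectral_mat n U a * spectral_mat n V b) ^\<^sub>m t * M) (\<lambda>i. (a i * b i) ^ t * w i)"
  using M
proof (induction t arbitrary: M w)
  case 0
  hence "M \<in> carrier_mat n n" unfolding trace_dominated_def by simp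
  moreover have "dim_row (spectral_mat n U a) = n" using spectral_mat_carrier[OF U(1)] by auto
  ultimately show ?case using 0 by simp
next
  case (Suc t)
  let ?A = "spectral_mat n U a" and ?B = "spectral_mat n V b"
  have c: "?A \<in> carrier_mat n n" "?B \<in> carrier_mat n n" "M \<in> carrier_mat n n"
    using U V Suc.prems unfolding trace_dominated_def by auto
  have "trace_dominated n (?A * (?B * M)) (\<lambda>i. a i * (b i * w i))"
    by (intro trace_dominated_spectral_mult U V a b Suc.prems)
  from Suc.IH[OF this] have "trace_dominated n ((?A * ?B) ^\<^sub>m t * (?A * (?B * M))) (\<lambda>i. (a i * b i) ^ t * (a i * (b i * w i)))" .
  moreover have "(?A * ?B) ^\<^sub>m t * (?A * (?B * M)) = (?A * ?B) ^\<^sub>m Suc t * M"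
    using assoc_mult_mat[OF c(1,2,3)]
      assoc_mult_mat[OF pow_carrier_mat[OF mult_carrier_mat[OF c(1,2)]] mult_carrier_mat[OF c(1,2)] c(3)]
    by simp
  ultimately show ?case by (simp add: mult_ac)
qed

section \<open>Powers of positive semidefinite matrices\<close>

lemma psd_conjugation:
  assumes A: "A \<in> carrier_mat n n" "psd_mat A" and S: "S \<in> carrier_mat n n" "mat_adjoint S = S"
  shows "psd_mat (S * A * S)"
  unfolding psd_mat_def hermitian_mat_def
proof (intro conjI ballI)
  have herm: "mat_adjoint A = A" using A unfolding psd_mat_def hermitian_mat_def by simp
  have SA: "S * A \<in> carrier_mat n n" by (rule mult_carrier_mat[OF S(1) A(1)])
  have C: "S * A * S \<in> carrier_mat n n" by (rule mult_carrier_mat[OF SA S(1)])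
  show "square_mat (S * A * S)" using C S(1) by auto
  show "mat_adjoint (S * A * S) = S * A * S"
    using mat_adjoint_mult[OF SA S(1)] mat_adjoint_mult[OF S(1) A(1)]
      assoc_mult_mat[OF S(1) A(1) S(1)] S(2) herm by simp
  fix v :: "complex vec" assume "v \<in> carrier_vec (dim_row (S * A * S))"
  hence v: "v \<in> carrier_vec n" using S(1) by simp
  have Sv: "S *\<^sub>v v \<in> carrier_vec n" by (rule mult_mat_vec_carrier[OF S(1) v])
  have "S * A * S *\<^sub>v v = S *\<^sub>v (A *\<^sub>v (S *\<^sub>v v))"
    using assoc_mult_mat_vec[OF SA S(1) v] assoc_mult_mat_vec[OF S(1) A(1) Sv] by simp
  hence "(S * A * S *\<^sub>v v) \<bullet>c v = (A *\<^sub>v (S *\<^sub>v v)) \<bullet>c (S *\<^sub>v v)"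
    using cscalar_prod_adjoint[OF S(1) mult_mat_vec_carrier[OF A(1) Sv] v] S(2) by simp
  thus "0 \<le> (S * A * S *\<^sub>v v) \<bullet>c v" using A Sv unfolding psd_mat_def by auto
qed

lemma psd_powr_of_nat:
  assumes A: "A \<in> carrier_mat n n" "psd_mat A" and s: "s \<ge> 1"
  shows "psd_powr A (real s) = A ^\<^sub>m s"
proof -
  from psd_sorted_diagonalization[OF A] obtain U where U: "U \<in> carrier_mat n n" "unitary_mat U"
    and A_eq: "A = spectral_mat n U (\<lambda>i. singular_values A ! i)" by blast
  have nonneg: "singular_values A ! i \<ge> 0" if "i < n" for i
    using psd_sorted_diagonalization(2,4)[OF A] that by auto
  have "psd_powr A (real s) = spectral_mat n U (\<lambda>i. if real s = 0 then 1 else (singular_values A ! i) powr real s)"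
    by (subst A_eq) (rule psd_powr_spectral_mat[OF U])
  also have "\<dots> = spectral_mat n U (\<lambda>i. (singular_values A ! i) ^ s)"
    using s nonneg by (intro spectral_mat_cong) (simp add: powr_realpow')
  also have "\<dots> = A ^\<^sub>m s"
    by (subst A_eq) (rule spectral_mat_pow[OF U, symmetric])
  finally show ?thesis .
qed

text \<open>Wherever two copies of \<open>S A S\<close> meet, the two adjacent factors \<open>S\<close> combine to \<open>S S\<close>.\<close>
lemma sandwich_pow:
  assumes A: "A \<in> carrier_mat n n" and S: "S \<in> carrier_mat n n"
  shows "(S * A * S) ^\<^sub>m Suc t = S * ((A * (S * S)) ^\<^sub>m t * A) * S"
proof (induction t)
  case 0
  show ?case using A S mult_carrier_mat[OF A S] mult_carrier_mat[OF S A] by simp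
next
  case (Suc t)
  let ?P = "(A * (S * S)) ^\<^sub>m t"
  have SS: "S * S \<in> carrier_mat n n" by (rule mult_carrier_mat[OF S S])
  have AB: "A * (S * S) \<in> carrier_mat n n" by (rule mult_carrier_mat[OF A SS])
  have P: "?P \<in> carrier_mat n n" by (rule pow_carrier_mat[OF AB])
  have PA: "?P * A \<in> carrier_mat n n" by (rule mult_carrier_mat[OF P A])
  have AS: "A * S \<in> carrier_mat n n" by (rule mult_carrier_mat[OF A S])
  have "(S * A * S) ^\<^sub>m Suc (Suc t) = S * (?P * A) * S * (S * A * S)"
    using Suc by simp
  also have "\<dots> = S * (?P * A) * S * (S * (A * S))" using assoc_mult_mat[OF S A S] by simp
  also have "\<dots> = S * (?P * A) * (S * (S * (A * S)))"
    by (rule assoc_mult_mat[OF mult_carrier_mat[OF S PA] S mult_carrier_mat[OF S AS]])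
  also have "\<dots> = S * ((?P * A) * (S * (S * (A * S))))"
    by (rule assoc_mult_mat[OF S PA mult_carrier_mat[OF S mult_carrier_mat[OF S AS]]])
  also have "S * (S * (A * S)) = (S * S) * (A * S)"
    by (rule assoc_mult_mat[OF S S AS, symmetric])
  also have "?P * A * (S * S * (A * S)) = ?P * (A * (S * S)) * (A * S)"
    using assoc_mult_mat[OF PA SS AS] assoc_mult_mat[OF P A SS] by simp
  also have "S * \<dots> = S * (?P * (A * (S * S)) * A) * S"
    using assoc_mult_mat[OF S mult_carrier_mat[OF mult_carrier_mat[OF P AB] A] S]
      assoc_mult_mat[OF mult_carrier_mat[OF P AB] A S] by simp
  finally show ?case by simp
qed

section \<open>Comparison of the two traces\<close>

theorem theorem3p2:
  fixes A B :: "complex mat" and n s :: nat and r :: real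
  assumes "A \<in> carrier_mat n n" and "B \<in> carrier_mat n n"
    and "psd_mat A" and "psd_mat B"
    and "r \<ge> 0" and "s \<ge> 1"
  shows "mat_trace (psd_powr (Sigma_up A) (real s) * psd_powr (Sigma_up B) (real s + r))
       \<ge> mat_trace (psd_powr B r *
            psd_powr (psd_powr B (1/2) * A * psd_powr B (1/2)) (real s))"
proof -
  note A = assms(1,3) and B = assms(2,4)
  define a where "a i = singular_values A ! i" for i
  define b where "b i = singular_values B ! i" for i
  obtain U where U: "U \<in> carrier_mat n n" "unitary_mat U" and A_eq: "A = spectral_mat n U a"
    using psd_sorted_diagonalization(1)[OF A] unfolding a_def by blast
  obtain V where V: "V \<in> carrier_mat n n" "unitary_mat V" and B_eq: "B = spectral_mat n V b"
    using psd_sorted_diagonalization(1)[OF B] unfolding b_def by blast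
  have a: "a j \<le> a i" if "i \<le> j" "j < n" for i j
    using psd_sorted_diagonalization(2,3)[OF A] that
    by (cases "i = j") (auto simp: a_def sorted_wrt_iff_nth_less)
  have b: "b j \<le> b i" if "i \<le> j" "j < n" for i j
    using psd_sorted_diagonalization(2,3)[OF B] that
    by (cases "i = j") (auto simp: b_def sorted_wrt_iff_nth_less)
  have a0: "0 \<le> a i" and b0: "0 \<le> b i" if "i < n" for i
    using psd_sorted_diagonalization(2,4)[OF A] psd_sorted_diagonalization(2,4)[OF B] that
    by (auto simp: a_def b_def)
  define f where "f i = (if r = 0 then 1 else b i powr r)" for i
  have f: "f j \<le> f i" if "i \<le> j" "j < n" for i j
    using b[OF that] b0[OF that(2)] assms(5) by (auto simp: f_def intro: powr_mono2)
  have f0: "0 \<le> f i" for i by (simp add: f_def)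
  define w where "w i = a i powr real s * b i powr (real s + r)" for i
  have s_r: "real s \<noteq> 0" "real s + r \<noteq> 0" using assms(5,6) by auto

  \<comment> \<open>Both factors on the left are diagonal, so that trace is an explicit sum.\<close>
  have "Sigma_up A = spectral_mat n (1\<^sub>m n) a" "Sigma_up B = spectral_mat n (1\<^sub>m n) b"
    using A(1) B(1) by (auto simp: Sigma_up_def spectral_mat_one a_def b_def)
  hence "psd_powr (Sigma_up A) (real s) * psd_powr (Sigma_up B) (real s + r) = spectral_mat n (1\<^sub>m n) w"
    using s_r by (simp add: psd_powr_spectral_mat[OF one_carrier_mat unitary_mat_one]
        spectral_mat_mult[OF one_carrier_mat unitary_mat_one] w_def[abs_def])
  hence lhs: "mat_trace (psd_powr (Sigma_up A) (real s) * psd_powr (Sigma_up B) (real s + r))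
      = complex_of_real (\<Sum>i<n. w i)"
    by (simp add: spectral_mat_one mat_trace_def mat_diag_def)

  \<comment> \<open>The trace on the right is rewritten as that of the word \<open>(S R S) (A B)\<^sup>t A\<close> with \<open>s = Suc t\<close>.\<close>
  define S where "S = spectral_mat n V (\<lambda>i. b i powr (1/2))"
  define R where "R = spectral_mat n V f"
  have S_eq: "psd_powr B (1/2) = S" and R_eq: "psd_powr B r = R"
    using psd_powr_spectral_mat[OF V, of b] unfolding B_eq[symmetric] S_def R_def f_def by auto
  have S: "S \<in> carrier_mat n n" "mat_adjoint S = S" and R: "R \<in> carrier_mat n n" "mat_adjoint R = R"
    using V unfolding S_def R_def by auto
  have sqrt: "b i powr (1/2) * b i powr (1/2) = b i" if "i < n" for i
    using b0[OF that] by (simp add: powr_half_sqrt)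
  have SS: "S * S = B"
    unfolding S_def B_eq spectral_mat_mult[OF V] by (rule spectral_mat_cong) (rule sqrt)
  have SRS: "S * R * S = spectral_mat n V (\<lambda>i. f i * b i)"
    unfolding S_def R_def spectral_mat_mult[OF V]
    by (rule spectral_mat_cong) (use sqrt in \<open>simp add: mult_ac\<close>)
  define C where "C = S * A * S"
  have C: "C \<in> carrier_mat n n" "psd_mat C"
    unfolding C_def using psd_conjugation[OF A S] mult_carrier_mat[OF mult_carrier_mat[OF S(1) A(1)] S(1)] by auto
  obtain t where t: "s = Suc t" using assms(6) by (cases s) auto
  define N where "N = (A * B) ^\<^sub>m t * A"
  have N: "N \<in> carrier_mat n n"
    unfolding N_def by (intro mult_carrier_mat[of _ n n] pow_carrier_mat A B)
  have Cs: "psd_powr C (real s) = C ^\<^sub>m s" by (rule psd_powr_of_nat[OF C assms(6)])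
  have Cs_eq: "C ^\<^sub>m s = S * N * S"
    unfolding C_def t N_def SS[symmetric] by (rule sandwich_pow[OF A(1) S(1)])
  define T where "T = mat_trace (R * C ^\<^sub>m s)"
  have SN: "S * N \<in> carrier_mat n n" and RS: "S * R \<in> carrier_mat n n"
    using S R N by auto
  have "T = mat_trace ((R * (S * N)) * S)"
    unfolding T_def Cs_eq using assoc_mult_mat[OF R(1) SN S(1)] by simp
  also have "\<dots> = mat_trace (S * (R * (S * N)))"
    by (rule mat_trace_comm[OF mult_carrier_mat[OF R(1) SN] S(1)])
  also have "S * (R * (S * N)) = S * R * S * N"
    using assoc_mult_mat[OF S(1) R(1) SN] assoc_mult_mat[OF RS S(1) N] by simp
  also have "cmod (mat_trace \<dots>) \<le> (\<Sum>i<n. f i * b i * ((a i * b i) ^ t * (a i * 1)))"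
  proof (rule trace_dominated_trace_le)
    have "trace_dominated n (A * 1\<^sub>m n) (\<lambda>i. a i * 1)"
      unfolding A_eq by (rule trace_dominated_spectral_mult[OF trace_dominated_one U a a0])
    hence "trace_dominated n A (\<lambda>i. a i * 1)" using right_mult_one_mat[OF A(1)] by simp
    from trace_dominated_pow_mult[where a = a and b = b and t = t, OF U V a a0 b b0 this]
    have "trace_dominated n N (\<lambda>i. (a i * b i) ^ t * (a i * 1))"
      unfolding N_def A_eq[symmetric] B_eq[symmetric] .
    thus "trace_dominated n (S * R * S * N) (\<lambda>i. f i * b i * ((a i * b i) ^ t * (a i * 1)))"
      unfolding SRS
      by (rule trace_dominated_spectral_mult[OF _ V]) (use b b0 f f0 in \<open>auto intro!: mult_mono\<close>)
  qed
  also have "\<dots> = (\<Sum>i<n. w i)"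
  proof (rule sum.cong[OF refl])
    fix i assume "i \<in> {..<n}"
    hence i: "i < n" by simp
    have "w i = a i ^ s * (b i ^ s * f i)"
      using a0[OF i] b0[OF i] assms(6) by (simp add: w_def f_def powr_add powr_realpow')
    thus "f i * b i * ((a i * b i) ^ t * (a i * 1)) = w i"
      by (simp add: t power_mult_distrib mult_ac)
  qed
  finally have T_le: "cmod T \<le> (\<Sum>i<n. w i)" .
  \<comment> \<open>The order on complex numbers also requires equal imaginary parts: the trace of a product of two
    hermitian matrices is real.\<close>
  have pow: "C ^\<^sub>m s \<in> carrier_mat n n" by (rule pow_carrier_mat[OF C(1)])
  have "mat_adjoint (C ^\<^sub>m s) = C ^\<^sub>m s"
  proof -
    obtain W where W: "W \<in> carrier_mat n n" "unitary_mat W"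
      and "C = spectral_mat n W (\<lambda>i. singular_values C ! i)"
      using psd_sorted_diagonalization(1)[OF C] by blast
    hence "C ^\<^sub>m s = spectral_mat n W (\<lambda>i. (singular_values C ! i) ^ s)"
      using spectral_mat_pow[OF W] by metis
    thus ?thesis using W by simp
  qed
  hence "cnj T = T"
    unfolding T_def using mat_trace_adjoint[OF mult_carrier_mat[OF R(1) pow]]
      mat_adjoint_mult[OF R(1) pow] mat_trace_comm[OF R(1) pow] R(2) by simp
  hence "Im T = 0" by (simp add: complex_eq_iff)
  moreover have "Re T \<le> (\<Sum>i<n. w i)" using T_le complex_Re_le_cmod[of T] by linarith
  ultimately show ?thesis
    unfolding lhs S_eq R_eq C_def[symmetric] Cs T_def[symmetric] by (simp add: less_eq_complex_def)
qed

end
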